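(* There is a constant $C>0$ (one may take $C=10^7$) such that for every integer $k\ge 2$, every tournament on at least $Ck^2\log^3 k$ vertices contains a $1$-subdivision of $T_k$.
   Context: A tournament is a directed graph in which every pair of distinct vertices is joined by exactly one directed edge. $T_k$ denotes the transitive tournament on $k$ vertices (vertices $v_1,\dots,v_k$, edges $v_i\to v_j$ for $i<j$). A $1$-subdivision of $T_k$ in a tournament $T$ consists of distinct vertices $b_1,\dots,b_k$ and, for each $i<j$, a directed path of length exactly $2$ from $b_i$ to $b_j$ (i.e. $b_i\to w_{ij}\to b_j$), where the middle vertices $w_{ij}$ are pairwise distinct and not among the $b_\ell$. $\log$ denotes the natural logarithm. *)

theory Defs
  imports Complex_Main "Graph_Theory.Digraph"
begin

text \<open>
  The locale \<^locale>\<open>digraph\<close> supplies finiteness and excludes loops.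
  The condition below counts arcs regardless of orientation, so between two
  distinct vertices there is one arc in exactly one of the two directions.
\<close>
locale tournament = digraph +
  assumes joined_by_unique_arc:
    "\<lbrakk>u \<in> verts G; v \<in> verts G; u \<noteq> v\<rbrakk>
      \<Longrightarrow> \<exists>!e. e \<in> arcs G \<and> {tail G e, head G e} = {u, v}"

definition ordered_pairs :: "nat \<Rightarrow> (nat \<times> nat) set" where
  "ordered_pairs k = {(i, j). 1 \<le> i \<and> i < j \<and> j \<le> k}"

text \<open>
  Only the values of \<open>b\<close> on \<open>{1..k}\<close> and of \<open>w\<close> on the pairs \<open>(i, j)\<close> with
  \<open>1 \<le> i < j \<le> k\<close> matter: \<open>b i\<close> are the branch vertices, and \<open>w (i, j)\<close>
  is the middle vertex of the path of length 2 from \<open>b i\<close> to \<open>b j\<close>.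
\<close>
definition one_subdivision_transitive_tournament ::
    "('a, 'b) pre_digraph \<Rightarrow> nat \<Rightarrow> (nat \<Rightarrow> 'a) \<Rightarrow> (nat \<times> nat \<Rightarrow> 'a) \<Rightarrow> bool" where
  "one_subdivision_transitive_tournament G k b w \<longleftrightarrow>
     b ` {1..k} \<subseteq> verts G \<and> inj_on b {1..k} \<and>
     w ` ordered_pairs k \<subseteq> verts G \<and> inj_on w (ordered_pairs k) \<and>
     b ` {1..k} \<inter> w ` ordered_pairs k = {} \<and>
     (\<forall>(i, j) \<in> ordered_pairs k. b i \<rightarrow>\<^bsub>G\<^esub> w (i, j) \<and> w (i, j) \<rightarrow>\<^bsub>G\<^esub> b j)"

end

theory Submission
  imports Defs "HOL-Analysis.Harmonic_Numbers"
begin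

text \<open>
  Write \<open>d(u, v)\<close> for the number of vertices on which the out-neighbourhoods of \<open>u\<close> and \<open>v\<close>
  differ. If \<open>u\<close> has at least the out-degree of \<open>v\<close>, there are about \<open>d(u, v) / 2\<close> paths of
  length 2 from \<open>u\<close> to \<open>v\<close>, so branch vertices are listed by decreasing out-degree. A ball of
  radius \<open>m\<close> for \<open>d\<close> has at most \<open>4 m + 2\<close> vertices, since the tournament induced on the ball is
  nearly constant along its columns, whereas a tournament matrix is antisymmetric. Hence the sum of
  \<open>1 / d(v, b)\<close> over \<open>v\<close> is only logarithmic, and averaging yields greedily \<open>k\<close> branch vertices,
  pairwise far apart, for which the sum of \<open>1 / d\<close> over all pairs is small. The middle vertices
  are then chosen greedily, the pairs with fewest paths first.
\<close>

section \<open>Distinct representatives\<close>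

text \<open>Serve a largest set \<open>L p\<close> last. Each summand is at least
  \<open>1 / card (L p)\<close>, so the bound 1 on the sum forces
  \<open>card P <= card (L p)\<close>. The other \<open>card P - 1\<close> choices therefore leave
  an element of \<open>L p\<close> free.\<close>

lemma distinct_representatives_of_sum_inverse_card:
  fixes L :: "'p \<Rightarrow> 'v set"
  assumes "finite P" "\<And>p. p \<in> P \<Longrightarrow> finite (L p)" "\<And>p. p \<in> P \<Longrightarrow> L p \<noteq> {}"
    and "(\<Sum>p\<in>P. 1 / real (card (L p))) \<le> 1"
  shows "\<exists>w. inj_on w P \<and> (\<forall>p\<in>P. w p \<in> L p)"
  using assms
proof (induction "card P" arbitrary: P)
  case 0
  then show ?case by auto
next
  case (Suc m)
  then have ne: "P \<noteq> {}" by auto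
  obtain p where p: "p \<in> P" "\<And>q. q \<in> P \<Longrightarrow> card (L q) \<le> card (L p)"
  proof -
    have "Max ((\<lambda>q. card (L q)) ` P) \<in> (\<lambda>q. card (L q)) ` P"
      using Suc.prems(1) ne by (intro Max_in) auto
    then obtain p where "p \<in> P" "card (L p) = Max ((\<lambda>q. card (L q)) ` P)" by auto
    then show ?thesis using Suc.prems(1) that by simp
  qed
  have pos: "card (L q) > 0" if "q \<in> P" for q
    using Suc.prems(2,3) that by (simp add: card_gt_0_iff)
  have "real (card P) / real (card (L p)) = (\<Sum>q\<in>P. 1 / real (card (L p)))" by simp
  also have "\<dots> \<le> (\<Sum>q\<in>P. 1 / real (card (L q)))"
    using pos p by (intro sum_mono divide_left_mono) auto
  finally have "real (card P) / real (card (L p)) \<le> 1" using Suc.prems(4) by linarith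
  then have le: "card P \<le> card (L p)" using pos[OF p(1)] by (simp add: divide_simps)
  have "(\<Sum>q\<in>P - {p}. 1 / real (card (L q))) \<le> (\<Sum>q\<in>P. 1 / real (card (L q)))"
    using Suc.prems(1) by (intro sum_mono2) auto
  then have "\<exists>w. inj_on w (P - {p}) \<and> (\<forall>q\<in>P - {p}. w q \<in> L q)"
    using Suc p by (intro Suc.hyps(1)) auto
  then obtain w where w: "inj_on w (P - {p})" "\<forall>q\<in>P - {p}. w q \<in> L q" by blast
  have "card (w ` (P - {p})) < card (L p)"
    using card_image_le[of "P - {p}" w] Suc.prems(1) le p(1) card_Diff1_less[of P p] by simp
  then obtain x where x: "x \<in> L p" "x \<notin> w ` (P - {p})"
    using Suc.prems(1) by (meson card_mono finite_Diff finite_imageI not_less subsetI)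
  have "inj_on (w(p := x)) P"
    using w(1) x(2) by (auto simp: inj_on_def)
  moreover have "\<forall>q\<in>P. (w(p := x)) q \<in> L q"
    using w(2) x(1) by auto
  ultimately show ?case by blast
qed

section \<open>Sums of reciprocal distances\<close>

text \<open>Since 1/(m(m+1)) = 1/m - 1/(m+1), the sum telescopes from \<open>d\<close> to
  \<open>R\<close>. Expressing 1/d through the indicators of \<open>d <= m\<close> lets bounds on
  ball sizes control sums of reciprocals.\<close>

lemma inverse_le_telescoping_sum:
  fixes d R :: nat
  assumes "R > 0"
  shows "1 / real d \<le> (\<Sum>m\<in>{1..<R}. of_bool (d \<le> m) / (real m * real (m + 1))) + 1 / real R"
proof (cases "d = 0 \<or> R \<le> d")
  case True
  have "0 \<le> (\<Sum>m\<in>{1..<R}. of_bool (d \<le> m) / (real m * real (m + 1)))"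
    by (intro sum_nonneg) auto
  moreover have "1 / real d \<le> 1 / real R" using True assms by (auto simp: divide_simps)
  ultimately show ?thesis by linarith
next
  case False
  then have "1 \<le> d" "d \<le> R" by auto
  have "1 / real d - 1 / real R = (\<Sum>m\<in>{d..<R}. 1 / real m - 1 / real (Suc m))"
    using sum_Suc_diff'[OF \<open>d \<le> R\<close>, of "\<lambda>m. - 1 / real m"] by simp
  also have "\<dots> = (\<Sum>m\<in>{d..<R}. of_bool (d \<le> m) / (real m * real (m + 1)))"
    using \<open>1 \<le> d\<close> by (intro sum.cong) (auto simp: field_simps)
  also have "\<dots> \<le> (\<Sum>m\<in>{1..<R}. of_bool (d \<le> m) / (real m * real (m + 1)))"
    using \<open>1 \<le> d\<close> by (intro sum_mono2) auto
  finally show ?thesis by linarith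
qed

text \<open>Elements at distance 0 contribute nothing to the sum, as \<open>1 / 0 = 0\<close>.\<close>

lemma sum_inverse_le_of_linear_balls:
  fixes f :: "'v \<Rightarrow> nat"
  assumes "finite V" "R > 0"
    and ball: "\<And>m. m \<ge> 1 \<Longrightarrow> card {v \<in> V. f v \<le> m} \<le> 6 * m"
  shows "(\<Sum>v\<in>V. 1 / real (f v)) \<le> 6 * harm R + real (card V) / real R"
proof -
  have "(\<Sum>v\<in>V. 1 / real (f v)) \<le>
      (\<Sum>v\<in>V. (\<Sum>m\<in>{1..<R}. of_bool (f v \<le> m) / (real m * real (m + 1))) + 1 / real R)"
    using assms(2) by (intro sum_mono inverse_le_telescoping_sum)
  also have "\<dots> = (\<Sum>m\<in>{1..<R}. \<Sum>v\<in>V. of_bool (f v \<le> m) / (real m * real (m + 1)))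
      + real (card V) / real R"
    by (subst sum.swap) (simp add: sum.distrib)
  \<comment> \<open>After the swap, level \<open>m\<close> counts the ball of radius
    \<open>m\<close>, and 6m/(m(m+1)) = 6/(m+1) is a harmonic term.\<close>
  also have "(\<Sum>m\<in>{1..<R}. \<Sum>v\<in>V. of_bool (f v \<le> m) / (real m * real (m + 1))) \<le>
      (\<Sum>m\<in>{1..<R}. 6 * inverse (real (m + 1)))"
  proof (intro sum_mono)
    fix m assume m: "m \<in> {1..<R}"
    have "(\<Sum>v\<in>V. of_bool (f v \<le> m) / (real m * real (m + 1)))
        = (\<Sum>v\<in>V. of_bool (f v \<le> m)) / (real m * real (m + 1))"
      by (simp add: sum_divide_distrib)
    also have "(\<Sum>v\<in>V. of_bool (f v \<le> m)) = real (card {v \<in> V. f v \<le> m})"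
      using assms(1) by (simp add: Int_def conj_commute)
    also have "\<dots> / (real m * real (m + 1)) \<le> real (6 * m) / (real m * real (m + 1))"
      using ball[of m] m by (intro divide_right_mono) (auto simp flip: of_nat_mult)
    also have "\<dots> = 6 * inverse (real (m + 1))" using m by (simp add: divide_inverse)
    finally show "(\<Sum>v\<in>V. of_bool (f v \<le> m) / (real m * real (m + 1))) \<le> 6 * inverse (real (m + 1))" .
  qed
  also have "(\<Sum>m\<in>{1..<R}. 6 * inverse (real (m + 1))) = 6 * (\<Sum>m\<in>{Suc 1..<Suc R}. inverse (real m))"
    by (subst sum.shift_bounds_Suc_ivl) (simp add: sum_distrib_left)
  also have "\<dots> \<le> 6 * harm R"
    unfolding harm_def by (intro mult_left_mono sum_mono2) auto
  finally show ?thesis by simp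
qed

section \<open>Greedy choice of separated points\<close>

text \<open>Points are added one at a time. The balls around those already chosen cover at most half
  of \<open>V\<close>, and an average point outside them has small total reciprocal distance to the
  chosen set.\<close>

lemma ex_separated_subset_sum_inverse_le:
  fixes d :: "'v \<Rightarrow> 'v \<Rightarrow> nat" and \<sigma> :: real
  assumes "finite V" "V \<noteq> {}"
    and sym: "\<And>u v. d u v = d v u" and refl: "\<And>v. d v v = 0"
    and near: "\<And>b. b \<in> V \<Longrightarrow> card {v \<in> V. d v b \<le> r} \<le> M" "2 * k * M \<le> card V"
    and load: "\<And>b. b \<in> V \<Longrightarrow> (\<Sum>v\<in>V. 1 / real (d v b)) \<le> \<sigma>"
    and "j \<le> k"
  shows "\<exists>B\<subseteq>V. card B = j \<and> (\<forall>u\<in>B. \<forall>v\<in>B. u \<noteq> v \<longrightarrow> r < d u v) \<and>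
    (\<Sum>u\<in>B. \<Sum>v\<in>B. 1 / real (d u v)) \<le> real j * (4 * real k * \<sigma> / real (card V))"
  using \<open>j \<le> k\<close>
proof (induction j)
  case 0
  then show ?case by (intro exI[of _ "{}"]) auto
next
  case (Suc j)
  \<comment> \<open>The average to beat: total weight at most k\<sigma>, spread over at least |V|/2
    admissible points.\<close>
  define c where "c = 2 * real k * \<sigma> / real (card V)"
  from Suc obtain B where B: "B \<subseteq> V" "card B = j" "\<forall>u\<in>B. \<forall>v\<in>B. u \<noteq> v \<longrightarrow> r < d u v"
    "(\<Sum>u\<in>B. \<Sum>v\<in>B. 1 / real (d u v)) \<le> real j * (2 * c)"
    unfolding c_def by (auto simp: algebra_simps)
  have finB: "finite B" using B(1) assms(1) finite_subset by blast
  have n: "card V > 0" using assms(1,2) by (simp add: card_gt_0_iff)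
  have \<sigma>: "\<sigma> \<ge> 0"
  proof -
    obtain b where "b \<in> V" using assms(2) by blast
    then show ?thesis using load[of b] sum_nonneg[of V "\<lambda>v. 1 / real (d v b)"] by force
  qed
  define A where "A = V - (\<Union>b\<in>B. {v \<in> V. d v b \<le> r})"
  have "card (\<Union>b\<in>B. {v \<in> V. d v b \<le> r}) \<le> (\<Sum>b\<in>B. card {v \<in> V. d v b \<le> r})"
    using finB by (rule card_UN_le)
  also have "\<dots> \<le> j * M"
    using near(1) B(1,2) sum_bounded_above[of B "\<lambda>b. card {v \<in> V. d v b \<le> r}" M] by auto
  finally have "2 * card (\<Union>b\<in>B. {v \<in> V. d v b \<le> r}) \<le> 2 * (j * M)" by simp
  also have "\<dots> \<le> card V"
    using near(2) mult_le_mono1[OF Suc_leD[OF Suc.prems], of "2 * M"] by (simp only: ac_simps)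
  finally have "card V \<le> 2 * card A"
    unfolding A_def using diff_card_le_card_Diff[of "\<Union>b\<in>B. {v \<in> V. d v b \<le> r}" V] finB assms(1) by simp
  then have A: "real (card V) \<le> 2 * real (card A)" by linarith
  have AV: "A \<subseteq> V" by (auto simp: A_def)
  have finA: "finite A" using AV assms(1) finite_subset by blast
  have "(\<Sum>v\<in>A. \<Sum>b\<in>B. 1 / real (d v b)) = (\<Sum>b\<in>B. \<Sum>v\<in>A. 1 / real (d v b))"
    by (rule sum.swap)
  also have "\<dots> \<le> (\<Sum>b\<in>B. \<sigma>)"
  proof (intro sum_mono)
    fix b assume "b \<in> B"
    have "(\<Sum>v\<in>A. 1 / real (d v b)) \<le> (\<Sum>v\<in>V. 1 / real (d v b))"
      using AV assms(1) by (intro sum_mono2) auto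
    then show "(\<Sum>v\<in>A. 1 / real (d v b)) \<le> \<sigma>" using load[of b] \<open>b \<in> B\<close> B(1) by auto
  qed
  also have "\<dots> = real j * \<sigma>" using B(2) by simp
  also have "\<dots> \<le> real k * \<sigma>" using Suc.prems \<sigma> by (intro mult_right_mono) auto
  also have "\<dots> = c * real (card V) / 2" using n by (simp add: c_def)
  also have "\<dots> \<le> real (card A) * c"
    using mult_left_mono[OF A, of c] \<sigma> by (simp add: c_def mult.commute)
  finally have avg: "(\<Sum>v\<in>A. \<Sum>b\<in>B. 1 / real (d v b)) \<le> real (card A) * c" .
  have "\<exists>v\<in>A. (\<Sum>b\<in>B. 1 / real (d v b)) \<le> c"
  proof (rule ccontr)
    assume "\<not> ?thesis"
    then have "(\<Sum>v\<in>A. c) < (\<Sum>v\<in>A. \<Sum>b\<in>B. 1 / real (d v b))"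
      using A n finA by (intro sum_strict_mono) auto
    then show False using avg by simp
  qed
  then obtain v where v: "v \<in> A" "(\<Sum>b\<in>B. 1 / real (d v b)) \<le> c" by blast
  have far: "r < d v b" if "b \<in> B" for b using v(1) that by (auto simp: A_def not_le)
  then have "v \<notin> B" using refl by fastforce
  \<comment> \<open>The new point adds a row and a column, equal by symmetry; its diagonal entry is
    \<open>1 / 0 = 0\<close>. This is the factor 2 between \<open>c\<close> and the claimed
    increment.\<close>
  have "(\<Sum>u\<in>insert v B. \<Sum>b\<in>insert v B. 1 / real (d u b))
      = 2 * (\<Sum>b\<in>B. 1 / real (d v b)) + (\<Sum>u\<in>B. \<Sum>b\<in>B. 1 / real (d u b))"
    using \<open>v \<notin> B\<close> finB by (simp add: refl sum.distrib sym[of _ v])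
  also have "\<dots> \<le> real (Suc j) * (2 * c)" using v(2) B(4) by (simp add: algebra_simps)
  finally have "(\<Sum>u\<in>insert v B. \<Sum>b\<in>insert v B. 1 / real (d u b)) \<le> real (Suc j) * (2 * c)" .
  moreover have "2 * c = 4 * real k * \<sigma> / real (card V)" by (simp add: c_def)
  moreover have "insert v B \<subseteq> V" using v(1) AV B(1) by auto
  moreover have "card (insert v B) = Suc j" using \<open>v \<notin> B\<close> finB B(2) by simp
  moreover have "\<forall>u\<in>insert v B. \<forall>w\<in>insert v B. u \<noteq> w \<longrightarrow> r < d u w"
    using B(3) far sym by auto
  ultimately show ?case by (intro exI[of _ "insert v B"]) metis
qed

section \<open>Distances between out-neighbourhoods in a tournament\<close>

context tournament
begin

lemma dominates_irrefl: "\<not> u \<rightarrow>\<^bsub>G\<^esub> u"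
  using no_loops by (auto simp: arcs_ends_def arc_to_ends_def)

lemma dominates_iff_not_dominates:
  assumes "u \<in> verts G" "v \<in> verts G" "u \<noteq> v"
  shows "u \<rightarrow>\<^bsub>G\<^esub> v \<longleftrightarrow> \<not> v \<rightarrow>\<^bsub>G\<^esub> u"
proof -
  obtain e where e: "e \<in> arcs G" "{tail G e, head G e} = {u, v}"
    and unique: "\<And>e'. e' \<in> arcs G \<Longrightarrow> {tail G e', head G e'} = {u, v} \<Longrightarrow> e' = e"
    using joined_by_unique_arc[OF assms] by blast
  \<comment> \<open>Every arc joining \<open>u\<close> and \<open>v\<close> is \<open>e\<close>, so
    domination in either direction is read off from the ordered ends of \<open>e\<close>.\<close>
  have dom: "x \<rightarrow>\<^bsub>G\<^esub> y \<longleftrightarrow> (tail G e, head G e) = (x, y)" if "{x, y} = {u, v}" for x y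
  proof
    assume "x \<rightarrow>\<^bsub>G\<^esub> y"
    then obtain e' where e': "e' \<in> arcs G" "tail G e' = x" "head G e' = y"
      by (auto simp: arcs_ends_def arc_to_ends_def)
    then have "e' = e" using that by (intro unique) simp_all
    then show "(tail G e, head G e) = (x, y)" using e' by simp
  next
    assume "(tail G e, head G e) = (x, y)"
    then show "x \<rightarrow>\<^bsub>G\<^esub> y" by (intro dominatesI[OF _ e(1)]) (simp add: arc_to_ends_def)
  qed
  have "(tail G e, head G e) = (u, v) \<or> (tail G e, head G e) = (v, u)"
    using e(2) by (auto simp: doubleton_eq_iff)
  then show ?thesis using dom[of u v] dom[of v u, OF insert_commute] assms(3) by auto
qed

definition out_nbhd :: "'a \<Rightarrow> 'a set" where
  "out_nbhd u = {w \<in> verts G. u \<rightarrow>\<^bsub>G\<^esub> w}"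

text \<open>The Hamming distance between two rows of the adjacency matrix.\<close>

definition out_dist :: "'a \<Rightarrow> 'a \<Rightarrow> nat" where
  "out_dist u v = card {w \<in> verts G. (u \<rightarrow>\<^bsub>G\<^esub> w) \<noteq> (v \<rightarrow>\<^bsub>G\<^esub> w)}"

lemma out_dist_sym: "out_dist u v = out_dist v u"
  unfolding out_dist_def by (rule arg_cong[where f = card]) auto

lemma out_dist_self: "out_dist v v = 0"
  by (simp add: out_dist_def)

text \<open>
  Every ordered pair of ball members on the same side of the out-neighbourhood of \<open>b\<close> contains,
  in one of its two orders, a disagreement with \<open>b\<close>; there are about half as many such pairs as
  pairs altogether.
\<close>

lemma card_out_dist_ball_le: "card {v \<in> verts G. out_dist v b \<le> m} \<le> 4 * m + 2"
proof -
  define S where "S = {v \<in> verts G. out_dist v b \<le> m}"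
  define X where "X = {v \<in> S. b \<rightarrow>\<^bsub>G\<^esub> v}"
  define Y where "Y = {v \<in> S. \<not> b \<rightarrow>\<^bsub>G\<^esub> v}"
  define g :: "'a \<Rightarrow> 'a \<Rightarrow> real" where "g v w = of_bool ((v \<rightarrow>\<^bsub>G\<^esub> w) \<noteq> (b \<rightarrow>\<^bsub>G\<^esub> w))" for v w
  have S: "S \<subseteq> verts G" "finite S" by (auto simp: S_def)
  have S_eq: "S = X \<union> Y" "X \<inter> Y = {}" "finite X" "finite Y" using S by (auto simp: X_def Y_def)
  have card_S: "real (card S) = real (card X) + real (card Y)"
    using S_eq by (simp add: card_Un_disjoint)
  have g_nonneg: "g v w \<ge> 0" for v w by (simp add: g_def)
  have row: "(\<Sum>w\<in>S. g v w) \<le> real m" if "v \<in> S" for v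
  proof -
    have "(\<Sum>w\<in>S. g v w) = real (card {w \<in> S. (v \<rightarrow>\<^bsub>G\<^esub> w) \<noteq> (b \<rightarrow>\<^bsub>G\<^esub> w)})"
      using S(2) by (simp add: g_def Int_def conj_commute)
    also have "card {w \<in> S. (v \<rightarrow>\<^bsub>G\<^esub> w) \<noteq> (b \<rightarrow>\<^bsub>G\<^esub> w)} \<le> out_dist v b"
      unfolding out_dist_def using S by (intro card_mono) auto
    finally show ?thesis using that by (simp add: S_def)
  qed
  have total: "(\<Sum>v\<in>S. \<Sum>w\<in>S. g v w) \<le> real (card S) * real m"
    using sum_bounded_above[of S "\<lambda>v. \<Sum>w\<in>S. g v w" "real m"] row by simp
  \<comment> \<open>For distinct \<open>v\<close>, \<open>w\<close> on the same side, the row of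
    \<open>b\<close> agrees at both, while exactly one of them dominates the other: one
    disagreement. On the diagonal there is no loop, so a member of \<open>X\<close> disagrees with
    \<open>b\<close> and a member of \<open>Y\<close> does not; hence the correction for
    \<open>Y\<close>.\<close>
  have pair: "g v w + g w v \<ge> of_bool (v \<in> X \<and> w \<in> X) + of_bool (v \<in> Y \<and> w \<in> Y)
      - of_bool (v = w \<and> v \<in> Y)" if "v \<in> S" "w \<in> S" for v w
    using dominates_iff_not_dominates[of v w] dominates_irrefl that S(1)
    by (cases "v = w") (auto simp: g_def X_def Y_def)
  have "real (card X) ^ 2 + real (card Y) ^ 2 - real (card Y) =
      (\<Sum>v\<in>S. \<Sum>w\<in>S. of_bool (v \<in> X \<and> w \<in> X) + of_bool (v \<in> Y \<and> w \<in> Y)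
        - of_bool (v = w \<and> v \<in> Y))"
  proof -
    have sq: "(\<Sum>v\<in>S. \<Sum>w\<in>S. of_bool (v \<in> Z \<and> w \<in> Z)) = real (card Z) ^ 2" if "Z \<subseteq> S" for Z
    proof -
      have "(\<Sum>v\<in>S. \<Sum>w\<in>S. of_bool (v \<in> Z \<and> w \<in> Z)) = (\<Sum>v\<in>S. \<Sum>w\<in>S. of_bool (v \<in> Z) * (of_bool (w \<in> Z) :: real))"
        by (simp add: of_bool_conj)
      also have "\<dots> = (\<Sum>v\<in>S. of_bool (v \<in> Z)) ^ 2"
        by (simp add: sum_product power2_eq_square)
      also have "(\<Sum>v\<in>S. of_bool (v \<in> Z)) = real (card Z)"
        using S(2) that by (simp add: Int_absorb1)
      finally show ?thesis .
    qed
    have "(\<Sum>v\<in>S. \<Sum>w\<in>S. of_bool (v = w \<and> v \<in> Y)) = (\<Sum>v\<in>S. of_bool (v \<in> Y) :: real)"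
    proof (rule sum.cong)
      fix v assume "v \<in> S"
      have "(\<Sum>w\<in>S. of_bool (v = w \<and> v \<in> Y)) = (\<Sum>w\<in>S. if v = w then of_bool (v \<in> Y) else 0 :: real)"
        by (intro sum.cong) auto
      then show "(\<Sum>w\<in>S. of_bool (v = w \<and> v \<in> Y)) = (of_bool (v \<in> Y) :: real)"
        using \<open>v \<in> S\<close> S(2) by simp
    qed simp
    also have "\<dots> = real (card Y)"
      using S(2) S_eq(1) by (simp add: Int_absorb1)
    finally show ?thesis using sq[of X] sq[of Y] S_eq(1)
      by (simp only: sum_subtractf sum.distrib) simp
  qed
  also have "\<dots> \<le> (\<Sum>v\<in>S. \<Sum>w\<in>S. g v w + g w v)" by (intro sum_mono pair)
  also have "\<dots> = (\<Sum>v\<in>S. \<Sum>w\<in>S. g v w) + (\<Sum>v\<in>S. \<Sum>w\<in>S. g w v)"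
    by (simp only: sum.distrib)
  also have "(\<Sum>v\<in>S. \<Sum>w\<in>S. g w v) = (\<Sum>v\<in>S. \<Sum>w\<in>S. g v w)" by (rule sum.swap)
  finally have "real (card X) ^ 2 + real (card Y) ^ 2 - real (card Y) \<le> 2 * (real (card S) * real m)"
    using total by linarith
  moreover have "real (card S) ^ 2 \<le> 2 * (real (card X) ^ 2 + real (card Y) ^ 2)"
    using sum_squares_ge_zero[of "real (card X) - real (card Y)" 0] unfolding card_S
    by (simp add: power2_eq_square algebra_simps)
  \<comment> \<open>With x = |X|, y = |Y|, s = x + y: s^2 <= 2(x^2 + y^2) <= 4sm + 2y, and y <=
    s.\<close>
  ultimately have "real (card S) * real (card S) \<le> real (card S) * (4 * real m + 2)"
    using card_S by (simp add: power2_eq_square algebra_simps)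
  then have "card S = 0 \<or> real (card S) \<le> 4 * real m + 2"
    by (metis mult_le_cancel_left_pos of_nat_0_less_iff neq0_conv)
  then show ?thesis unfolding S_def by linarith
qed

text \<open>The two one-sided differences make up the distance, and the one from the larger set is
  at least as large. Apart from \<open>v\<close> itself, its elements are middle vertices of paths
  from \<open>u\<close> to \<open>v\<close>.\<close>

lemma out_dist_le_card_out_nbhd_diff:
  assumes "card (out_nbhd v) \<le> card (out_nbhd u)"
  shows "out_dist u v \<le> 2 * card (out_nbhd u - out_nbhd v)"
proof -
  have fin: "finite (out_nbhd x)" for x by (simp add: out_nbhd_def)
  have "{w \<in> verts G. (u \<rightarrow>\<^bsub>G\<^esub> w) \<noteq> (v \<rightarrow>\<^bsub>G\<^esub> w)} = (out_nbhd u - out_nbhd v) \<union> (out_nbhd v - out_nbhd u)"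
    by (auto simp: out_nbhd_def)
  then have "out_dist u v \<le> card (out_nbhd u - out_nbhd v) + card (out_nbhd v - out_nbhd u)"
    unfolding out_dist_def using card_Un_le by metis
  moreover have "card (out_nbhd v - out_nbhd u) \<le> card (out_nbhd u - out_nbhd v)"
    using card_le_sym_Diff[OF fin fin assms] .
  ultimately show ?thesis by linarith
qed

section \<open>Building the subdivision\<close>

lemma ex_one_subdivision_of_separated:
  assumes B: "B \<subseteq> verts G" "card B = k"
    and far: "\<And>u v. u \<in> B \<Longrightarrow> v \<in> B \<Longrightarrow> u \<noteq> v \<Longrightarrow> 4 * k < out_dist u v"
    and load: "(\<Sum>u\<in>B. \<Sum>v\<in>B. 1 / real (out_dist u v)) \<le> 1 / 4"
  shows "\<exists>b w. one_subdivision_transitive_tournament G k b w"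
proof -
  have finB: "finite B" using finite_subset[OF B(1)] by simp
  obtain ys where ys: "set ys = B" "distinct ys" using finite_distinct_list[OF finB] by blast
  \<comment> \<open>Decreasing out-degree makes every required path run from a higher or equal
    out-degree to a lower one.\<close>
  define xs where "xs = rev (sort_key (\<lambda>v. card (out_nbhd v)) ys)"
  have xs: "set xs = B" "distinct xs" "length xs = k"
    using ys B(2) distinct_card[OF ys(2)] by (simp_all add: xs_def)
  have desc: "card (out_nbhd (xs ! j)) \<le> card (out_nbhd (xs ! i))" if "i \<le> j" "j < k" for i j
  proof -
    have "sorted (rev (map (\<lambda>v. card (out_nbhd v)) xs))" by (simp add: xs_def rev_map)
    then show ?thesis using sorted_rev_nth_mono[of "map (\<lambda>v. card (out_nbhd v)) xs" i j] that xs(3) by simp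
  qed
  define b where "b i = xs ! (i - 1)" for i
  have b_inj: "inj_on b {1..k}"
  proof (rule inj_onI)
    fix i j assume ij: "i \<in> {1..k}" "j \<in> {1..k}" "b i = b j"
    then have "i - 1 = j - 1"
      unfolding b_def using xs(2,3) by (subst (asm) nth_eq_iff_index_eq) auto
    then show "i = j" using ij by auto
  qed
  have b_in: "b i \<in> B" if "i \<in> {1..k}" for i
    unfolding b_def xs(1)[symmetric] using that xs(3) by (intro nth_mem) auto
  have b_desc: "card (out_nbhd (b j)) \<le> card (out_nbhd (b i))" if "i < j" "j \<le> k" for i j
    using desc[of "i - 1" "j - 1"] that by (simp add: b_def)
  define P where "P = ordered_pairs k"
  have P: "i \<in> {1..k}" "j \<in> {1..k}" "i < j" if "(i, j) \<in> P" for i j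
    using that by (auto simp: P_def ordered_pairs_def)
  have P_sub: "P \<subseteq> {1..k} \<times> {1..k}" using P by auto
  have finP: "finite P" using P_sub finite_subset by blast
  \<comment> \<open>Candidate middle vertices. Excluding \<open>B\<close> keeps them off the branch
    vertices, in particular off \<open>b j\<close>, so not being dominated by \<open>b j\<close>
    means dominating it.\<close>
  define L where "L = (\<lambda>(i, j). (out_nbhd (b i) - out_nbhd (b j)) - B)"
  \<comment> \<open>The one-sided difference D is at least half the distance, hence exceeds 2k;
    removing \<open>B\<close> costs at most k, leaving at least D/2, a quarter of the
    distance.\<close>
  have card_L: "out_dist (b i) (b j) \<le> 4 * card (L (i, j)) \<and> 0 < out_dist (b i) (b j)"
    if "(i, j) \<in> P" for i j
  proof -
    have "b i \<noteq> b j" using P[OF that] b_inj by (auto dest: inj_onD)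
    then have "4 * k < out_dist (b i) (b j)" using far P[OF that] b_in by blast
    moreover have "out_dist (b i) (b j) \<le> 2 * card (out_nbhd (b i) - out_nbhd (b j))"
      using P[OF that] by (intro out_dist_le_card_out_nbhd_diff b_desc) auto
    moreover have "card (out_nbhd (b i) - out_nbhd (b j)) - k \<le> card (L (i, j))"
      unfolding L_def B(2)[symmetric] using diff_card_le_card_Diff[OF finB] by auto
    ultimately show ?thesis by linarith
  qed
  have L_pos: "0 < card (L p)" if "p \<in> P" for p
    using card_L that by (cases p) fastforce
  have "(\<Sum>p\<in>P. 1 / real (card (L p))) \<le>
      (\<Sum>p\<in>P. 4 * (case p of (i, j) \<Rightarrow> 1 / real (out_dist (b i) (b j))))"
  proof (intro sum_mono)
    fix p assume "p \<in> P"
    obtain i j where p: "p = (i, j)" by (cases p)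
    have "real (out_dist (b i) (b j)) \<le> 4 * real (card (L p))" "0 < out_dist (b i) (b j)"
      using card_L[of i j] \<open>p \<in> P\<close> by (auto simp: p)
    then show "1 / real (card (L p)) \<le> 4 * (case p of (i, j) \<Rightarrow> 1 / real (out_dist (b i) (b j)))"
      using L_pos[OF \<open>p \<in> P\<close>] by (simp add: p field_simps)
  qed
  also have "\<dots> = 4 * (\<Sum>(i, j)\<in>P. 1 / real (out_dist (b i) (b j)))"
    by (simp add: sum_distrib_left)
  \<comment> \<open>The additional pairs contribute nonnegative terms.\<close>
  also have "\<dots> \<le> 4 * (\<Sum>(i, j)\<in>{1..k} \<times> {1..k}. 1 / real (out_dist (b i) (b j)))"
    using P_sub by (intro mult_left_mono sum_mono2) auto
  also have "(\<Sum>(i, j)\<in>{1..k} \<times> {1..k}. 1 / real (out_dist (b i) (b j)))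
      = (\<Sum>u\<in>B. \<Sum>v\<in>B. 1 / real (out_dist u v))"
  proof -
    have img: "b ` {1..k} = B"
      using b_in b_inj B(2) finB by (intro card_subset_eq) (auto simp: card_image)
    have "(\<Sum>u\<in>B. \<Sum>v\<in>B. 1 / real (out_dist u v))
        = (\<Sum>i\<in>{1..k}. \<Sum>j\<in>{1..k}. 1 / real (out_dist (b i) (b j)))"
      unfolding img[symmetric] sum.reindex[OF b_inj] comp_def ..
    then show ?thesis by (simp add: sum.cartesian_product)
  qed
  finally have "(\<Sum>p\<in>P. 1 / real (card (L p))) \<le> 1" using load by simp
  moreover have "finite (L p)" "L p \<noteq> {}" if "p \<in> P" for p
    using L_pos[OF that] by (auto simp: card_gt_0_iff)
  ultimately obtain w where w: "inj_on w P" "\<And>p. p \<in> P \<Longrightarrow> w p \<in> L p"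
    using distinct_representatives_of_sum_inverse_card[of P L] finP by blast
  have path: "b i \<rightarrow>\<^bsub>G\<^esub> w (i, j) \<and> w (i, j) \<rightarrow>\<^bsub>G\<^esub> b j" if "(i, j) \<in> P" for i j
  proof -
    have wL: "w (i, j) \<in> verts G" "b i \<rightarrow>\<^bsub>G\<^esub> w (i, j)" "\<not> b j \<rightarrow>\<^bsub>G\<^esub> w (i, j)" "w (i, j) \<notin> B"
      using w(2)[OF that] by (auto simp: L_def out_nbhd_def)
    have bj: "b j \<in> B" using b_in P[OF that] by blast
    then have "w (i, j) \<noteq> b j" using wL(4) by metis
    then have "w (i, j) \<rightarrow>\<^bsub>G\<^esub> b j"
      using dominates_iff_not_dominates[OF wL(1) subsetD[OF B(1) bj]] wL(3) by blast
    then show ?thesis using wL(2) by blast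
  qed
  have "w ` P \<subseteq> verts G - B" using w(2) by (force simp: L_def out_nbhd_def)
  moreover have "b ` {1..k} \<subseteq> B" using b_in by blast
  ultimately have "one_subdivision_transitive_tournament G k b w"
    unfolding one_subdivision_transitive_tournament_def P_def[symmetric]
    using b_inj w(1) B(1) path by auto
  then show ?thesis by blast
qed

end

section \<open>Choice of constants\<close>

theorem theorem1p3:
  fixes G :: "('a, 'b) pre_digraph" and k :: nat
  assumes "k \<ge> 2"
    and "tournament G"
    and "real (card (verts G)) \<ge> 10 ^ 7 * real k ^ 2 * ln (real k) ^ 3"
  shows "\<exists>b w. one_subdivision_transitive_tournament G k b w"
proof -
  interpret tournament G by fact
  define n where "n = real (card (verts G))"
  \<comment> \<open>Chosen so that the term \<open>n / real R\<close> contributes 4k^2/R = 1/8, half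
    of the allowed load 1/4.\<close>
  define R where "R = 32 * k ^ 2"
  define \<sigma> where "\<sigma> = 6 * harm R + n / real R"
  have ln2: "2 / 3 \<le> ln (2 :: real)" by (rule ln2_ge_two_thirds)
  have ln_k: "ln 2 \<le> ln (real k)" using assms(1) by simp
  have k2: "real k ^ 2 > 0" "R > 0" using assms(1) by (auto simp: R_def)
  \<comment> \<open>Two of the three logarithmic factors are bounded below by 2/3 each, giving n >=
    3000 k^2 ln k.\<close>
  have "(2 / 3) ^ 2 \<le> ln (real k) ^ 2" using ln2 ln_k by (intro power_mono) auto
  then have "4 / 9 * ln (real k) \<le> ln (real k) ^ 2 * ln (real k)"
    using ln2 ln_k by (intro mult_right_mono) (auto simp: power2_eq_square)
  then have "3000 * ln (real k) \<le> 10 ^ 7 * ln (real k) ^ 3"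
    using ln2 ln_k by (simp add: power3_eq_cube power2_eq_square)
  then have "3000 * ln (real k) * real k ^ 2 \<le> 10 ^ 7 * ln (real k) ^ 3 * real k ^ 2"
    by (intro mult_right_mono) auto
  then have n: "3000 * ln (real k) * real k ^ 2 \<le> n"
    using assms(3) by (simp add: n_def mult.commute mult.left_commute)
  have "1000 * real k ^ 2 \<le> 3000 * ln (real k) * real k ^ 2"
    using ln2 ln_k by (intro mult_right_mono) auto
  then have n': "1000 * real k ^ 2 \<le> n" using n by linarith
  then have n_pos: "n > 0" using k2 by linarith
  \<comment> \<open>The library sequence is indexed from \<open>Suc 0\<close>, so \<open>R\<close>
    corresponds to index \<open>R - 1\<close>.\<close>
  have "harm R - ln (real R) \<le> harm 1 - ln (real 1)"
    using decseqD[OF decseq_harm_diff_ln, of 0 "R - 1"] k2(2) by simp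
  then have "harm R \<le> ln (real R) + (1 :: real)" by (simp add: harm_def)
  also have "ln (real R) = 5 * ln 2 + 2 * ln (real k)"
  proof -
    have "real R = 2 ^ 5 * real k ^ 2" by (simp add: R_def)
    then show ?thesis using assms(1) by (simp only: ln_mult ln_realpow) (simp add: ln_mult ln_realpow)
  qed
  also have "5 * ln 2 + 2 * ln (real k) + 1 \<le> 9 * ln (real k)" using ln2 ln_k by linarith
  finally have harm: "harm R \<le> 9 * ln (real k)" .
  have ball: "card {v \<in> verts G. out_dist v b \<le> m} \<le> 6 * m" if "m \<ge> 1" for b m
    using card_out_dist_ball_le[of b m] that by linarith
  \<comment> \<open>Radius 4k gives balls of at most 6 * 4k = 24k vertices; twice \<open>k\<close>
    of them is 48k^2, below the bound 1000k^2 on \<open>n\<close>.\<close>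
  have "\<exists>B\<subseteq>verts G. card B = k \<and> (\<forall>u\<in>B. \<forall>v\<in>B. u \<noteq> v \<longrightarrow> 4 * k < out_dist u v) \<and>
    (\<Sum>u\<in>B. \<Sum>v\<in>B. 1 / real (out_dist u v)) \<le> real k * (4 * real k * \<sigma> / real (card (verts G)))"
  proof (rule ex_separated_subset_sum_inverse_le[where M = "24 * k"])
    show "verts G \<noteq> {}" using n_pos by (auto simp: n_def)
    show "card {v \<in> verts G. out_dist v b \<le> 4 * k} \<le> 24 * k" for b
      using ball[of "4 * k" b] assms(1) by simp
    have "real (2 * k * (24 * k)) \<le> real (card (verts G))"
      using n' k2 by (simp add: n_def power2_eq_square)
    then show "2 * k * (24 * k) \<le> card (verts G)" by (simp only: of_nat_le_iff)
    show "(\<Sum>v\<in>verts G. 1 / real (out_dist v b)) \<le> \<sigma>" for b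
      unfolding \<sigma>_def n_def using k2(2) ball by (intro sum_inverse_le_of_linear_balls) auto
  qed (auto simp: out_dist_sym out_dist_self)
  then obtain B where B: "B \<subseteq> verts G" "card B = k"
    "\<forall>u\<in>B. \<forall>v\<in>B. u \<noteq> v \<longrightarrow> 4 * k < out_dist u v"
    "(\<Sum>u\<in>B. \<Sum>v\<in>B. 1 / real (out_dist u v)) \<le> real k * (4 * real k * \<sigma> / n)"
    unfolding n_def by blast
  have "real k * (4 * real k * \<sigma> / n) = 24 * real k ^ 2 * harm R / n + 1 / 8"
    using n_pos k2 by (simp add: \<sigma>_def R_def field_simps power2_eq_square)
  moreover have "24 * real k ^ 2 * harm R / n \<le> 1 / 8"
  proof -
    \<comment> \<open>Here 192 = 8 * 24, and 192 * 9 = 1728 stays below 3000.\<close>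
    have "192 * (real k ^ 2 * harm R) \<le> 192 * (real k ^ 2 * (9 * ln (real k)))"
      using harm by (intro mult_left_mono) auto
    also have "\<dots> \<le> 3000 * ln (real k) * real k ^ 2" using ln2 ln_k k2 by simp
    finally show ?thesis using n n_pos by (simp add: field_simps)
  qed
  ultimately have "(\<Sum>u\<in>B. \<Sum>v\<in>B. 1 / real (out_dist u v)) \<le> 1 / 4" using B(4) by linarith
  then show ?thesis using B by (intro ex_one_subdivision_of_separated[of B]) auto
qed

end
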